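(* Let $G$ be a connected, locally finite metric graph and let $k,m\ge 0$. If $G$ is $(k,m)$-edge-chordal, then there exists $\varepsilon>0$ such that $G$ is $\varepsilon$-densely $(k,m)$-path-chordal.
   Context: A metric graph is a graph $G$ in which every edge $e$ is regarded as isometric to an interval $[0,l_e]$ (no restriction on the lengths $l_e>0$); interior points of edges are points of $G$, and $d(x,y)$ is the length of a shortest path in $G$ joining $x$ and $y$. A cycle is a simple closed curve in $G$ (a closed path through vertices that are all distinct except the first and the last). For a cycle $C$, $d_C$ denotes the length metric on $C$ and $L(\cdot)$ denotes length. A shortcut in a cycle $C$ is a path $\sigma$ in $G$ joining two vertices $p,q$ of $C$ with $L(\sigma)<d_C(p,q)$; it is strict if $\sigma\cap C=\{p,q\}$, and then $p,q$ are called shortcut vertices associated to $\sigma$. An edge-shortcut is an edge of $G$ which is a shortcut of $C$. $G$ is $(k,m)$-edge-chordal if every cycle $C$ with $L(C)\ge k$ has an edge-shortcut $e$ with $L(e)\le m$. A subset $A$ of a metric space $X$ is $\varepsilon$-dense if for every $x\in X$ there is $a\in A$ with $d(a,x)<\varepsilon$. $G$ is $\varepsilon$-densely $(k,m)$-path-chordal if for every cycle $C$ with $L(C)\ge k$ there exist strict shortcuts $\sigma_1,\dots,\sigma_r$ of $C$ with $L(\sigma_i)\le m$ such that their associated shortcut vertices form an $\varepsilon$-dense subset of $(C,d_C)$. *)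

theory Defs
  imports Complex_Main
begin

text \<open>
  Graphs may have loops and multiple edges. The orientation given by \<open>src\<close> and \<open>tgt\<close>
  serves only to parametrise an edge \<open>e\<close> by the interval from \<open>0\<close> to \<open>len e\<close>.
\<close>

record ('v, 'e) mgraph =
  verts :: "'v set"
  edges :: "'e set"
  src :: "'e \<Rightarrow> 'v"
  tgt :: "'e \<Rightarrow> 'v"
  len :: "'e \<Rightarrow> real"

definition metric_graph :: "('v, 'e) mgraph \<Rightarrow> bool" where
  "metric_graph G \<longleftrightarrow>
     (\<forall>e \<in> edges G. src G e \<in> verts G \<and> tgt G e \<in> verts G \<and> 0 < len G e)"

definition locally_finite :: "('v, 'e) mgraph \<Rightarrow> bool" where
  "locally_finite G \<longleftrightarrow>
     (\<forall>v \<in> verts G. finite {e \<in> edges G. src G e = v \<or> tgt G e = v})"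

datatype ('v, 'e) point = Vertex 'v | Inner 'e real

text \<open>The point at distance \<open>t\<close> from the source along the edge \<open>e\<close>.\<close>

definition edge_point :: "('v, 'e) mgraph \<Rightarrow> 'e \<Rightarrow> real \<Rightarrow> ('v, 'e) point" where
  "edge_point G e t =
     (if t = 0 then Vertex (src G e)
      else if t = len G e then Vertex (tgt G e)
      else Inner e t)"

definition points :: "('v, 'e) mgraph \<Rightarrow> ('v, 'e) point set" where
  "points G = Vertex ` verts G \<union> (\<Union>e \<in> edges G. edge_point G e ` {0..len G e})"

text \<open>
  A path is a list of segments \<open>(e, s, t)\<close>, each running along the edge \<open>e\<close> from
  parameter \<open>s\<close> to parameter \<open>t\<close>. Its end points may be interior points of edges.
\<close>

type_synonym 'e path = "('e \<times> real \<times> real) list"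

fun path_between ::
  "('v, 'e) mgraph \<Rightarrow> ('v, 'e) point \<Rightarrow> 'e path \<Rightarrow> ('v, 'e) point \<Rightarrow> bool" where
  "path_between G x [] y \<longleftrightarrow> x \<in> points G \<and> x = y"
| "path_between G x ((e, s, t) # \<sigma>) y \<longleftrightarrow>
     e \<in> edges G \<and> s \<in> {0..len G e} \<and> t \<in> {0..len G e} \<and>
     x = edge_point G e s \<and> path_between G (edge_point G e t) \<sigma> y"

definition path_length :: "'e path \<Rightarrow> real" where
  "path_length \<sigma> = (\<Sum>(e, s, t) \<leftarrow> \<sigma>. \<bar>t - s\<bar>)"

definition path_image :: "('v, 'e) mgraph \<Rightarrow> 'e path \<Rightarrow> ('v, 'e) point set" where
  "path_image G \<sigma> = (\<Union>(e, s, t) \<in> set \<sigma>. edge_point G e ` {min s t..max s t})"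

definition connected_graph :: "('v, 'e) mgraph \<Rightarrow> bool" where
  "connected_graph G \<longleftrightarrow> (\<forall>x \<in> points G. \<forall>y \<in> points G. \<exists>\<sigma>. path_between G x \<sigma> y)"

definition gdist :: "('v, 'e) mgraph \<Rightarrow> ('v, 'e) point \<Rightarrow> ('v, 'e) point \<Rightarrow> real" where
  "gdist G x y = Inf {path_length \<sigma> | \<sigma>. path_between G x \<sigma> y}"

definition joins :: "('v, 'e) mgraph \<Rightarrow> 'e \<Rightarrow> 'v \<Rightarrow> 'v \<Rightarrow> bool" where
  "joins G e u v \<longleftrightarrow> src G e = u \<and> tgt G e = v \<or> src G e = v \<and> tgt G e = u"

text \<open>
  A cycle is a subgraph \<open>C\<close> of \<open>G\<close>, hence itself a metric graph; its length metric is
  \<open>gdist C\<close>. Distinctness of the edges only matters for two vertices, where it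
  excludes traversing one edge back and forth.
\<close>

definition cycle :: "('v, 'e) mgraph \<Rightarrow> ('v, 'e) mgraph \<Rightarrow> bool" where
  "cycle G C \<longleftrightarrow>
     (\<exists>vs es. es \<noteq> [] \<and> length vs = length es \<and> distinct vs \<and> distinct es \<and>
        set vs \<subseteq> verts G \<and> set es \<subseteq> edges G \<and>
        (\<forall>i < length es. joins G (es ! i) (vs ! i) (vs ! (Suc i mod length es))) \<and>
        C = G\<lparr>verts := set vs, edges := set es\<rparr>)"

definition total_length :: "('v, 'e) mgraph \<Rightarrow> real" where
  "total_length C = (\<Sum>e \<in> edges C. len C e)"

definition shortcut ::
  "('v, 'e) mgraph \<Rightarrow> ('v, 'e) mgraph \<Rightarrow> 'e path \<Rightarrow> 'v \<Rightarrow> 'v \<Rightarrow> bool" where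
  "shortcut G C \<sigma> p q \<longleftrightarrow>
     p \<in> verts C \<and> q \<in> verts C \<and> path_between G (Vertex p) \<sigma> (Vertex q) \<and>
     path_length \<sigma> < gdist C (Vertex p) (Vertex q)"

definition strict_shortcut ::
  "('v, 'e) mgraph \<Rightarrow> ('v, 'e) mgraph \<Rightarrow> 'e path \<Rightarrow> 'v \<Rightarrow> 'v \<Rightarrow> bool" where
  "strict_shortcut G C \<sigma> p q \<longleftrightarrow>
     shortcut G C \<sigma> p q \<and> path_image G \<sigma> \<inter> points C = {Vertex p, Vertex q}"

definition edge_shortcut :: "('v, 'e) mgraph \<Rightarrow> ('v, 'e) mgraph \<Rightarrow> 'e \<Rightarrow> bool" where
  "edge_shortcut G C e \<longleftrightarrow> e \<in> edges G \<and> (\<exists>p q. shortcut G C [(e, 0, len G e)] p q)"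

definition edge_chordal :: "('v, 'e) mgraph \<Rightarrow> real \<Rightarrow> real \<Rightarrow> bool" where
  "edge_chordal G k m \<longleftrightarrow>
     (\<forall>C. cycle G C \<and> total_length C \<ge> k \<longrightarrow> (\<exists>e. edge_shortcut G C e \<and> len G e \<le> m))"

definition eps_dense :: "real \<Rightarrow> 'a set \<Rightarrow> 'a set \<Rightarrow> ('a \<Rightarrow> 'a \<Rightarrow> real) \<Rightarrow> bool" where
  "eps_dense \<epsilon> A X d \<longleftrightarrow> A \<subseteq> X \<and> (\<forall>x \<in> X. \<exists>a \<in> A. d a x < \<epsilon>)"

definition densely_path_chordal :: "real \<Rightarrow> ('v, 'e) mgraph \<Rightarrow> real \<Rightarrow> real \<Rightarrow> bool" where
  "densely_path_chordal \<epsilon> G k m \<longleftrightarrow>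
     (\<forall>C. cycle G C \<and> total_length C \<ge> k \<longrightarrow>
        (\<exists>S. finite S \<and>
           (\<forall>(\<sigma>, p, q) \<in> S. strict_shortcut G C \<sigma> p q \<and> path_length \<sigma> \<le> m) \<and>
           eps_dense \<epsilon> (\<Union>(\<sigma>, p, q) \<in> S. {Vertex p, Vertex q}) (points C) (gdist C)))"

end

theory Submission
  imports Defs
begin

text \<open>
  Let \<open>x\<close> lie on the edge \<open>a\<close> of a cycle \<open>C\<close> of length at least \<open>k\<close>, and let \<open>K\<close> be the finite graph
  obtained from \<open>C\<close> by adding its edge-shortcuts of length at most \<open>m\<close>. A shortest cycle \<open>D\<close> of \<open>K\<close>
  through \<open>a\<close> is isometric in \<open>K\<close>, since \<open>D\<close> without \<open>a\<close> is a geodesic of \<open>K\<close> without \<open>a\<close>. An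
  edge-shortcut of \<open>D\<close> of length at most \<open>m\<close> would thus be one of \<open>C\<close>, hence an edge of \<open>K\<close>, and could
  not shorten \<open>D\<close>; so edge-chordality leaves only the possibility that \<open>D\<close> is shorter than \<open>k\<close>. In
  particular \<open>D\<close> differs from \<open>C\<close>, and following \<open>D\<close> from \<open>x\<close> along edges of \<open>C\<close> one meets a shortcut
  vertex within distance \<open>k\<close>.
\<close>

section \<open>Paths and distances\<close>

abbreviation vdist :: "('v, 'e) mgraph \<Rightarrow> 'v \<Rightarrow> 'v \<Rightarrow> real" where
  "vdist H u v \<equiv> gdist H (Vertex u) (Vertex v)"

lemma metric_graphD:
  assumes "metric_graph H" "e \<in> edges H"
  shows "src H e \<in> verts H" "tgt H e \<in> verts H" "0 < len H e"
  using assms by (auto simp: metric_graph_def)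

lemma edge_point_0 [simp]: "edge_point H e 0 = Vertex (src H e)"
  by (simp add: edge_point_def)

lemma edge_point_len:
  "metric_graph H \<Longrightarrow> e \<in> edges H \<Longrightarrow> edge_point H e (len H e) = Vertex (tgt H e)"
  by (auto simp: edge_point_def metric_graph_def)

lemma edge_point_in_points:
  "e \<in> edges H \<Longrightarrow> t \<in> {0..len H e} \<Longrightarrow> edge_point H e t \<in> points H"
  unfolding points_def by blast

lemma Vertex_in_points [intro]: "v \<in> verts H \<Longrightarrow> Vertex v \<in> points H"
  by (auto simp: points_def)

lemma pointsE:
  assumes "x \<in> points H"
  obtains (vertex) v where "v \<in> verts H" "x = Vertex v"
    | (edge) e t where "e \<in> edges H" "t \<in> {0..len H e}" "x = edge_point H e t"
  using assms unfolding points_def by auto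

lemma path_length_Nil [simp]: "path_length [] = 0"
  by (simp add: path_length_def)

lemma path_length_Cons [simp]: "path_length ((e, s, t) # \<sigma>) = \<bar>t - s\<bar> + path_length \<sigma>"
  by (simp add: path_length_def)

lemma path_length_append [simp]: "path_length (\<sigma> @ \<tau>) = path_length \<sigma> + path_length \<tau>"
  by (simp add: path_length_def)

lemma path_length_nonneg: "0 \<le> path_length \<sigma>"
  by (auto simp: path_length_def intro!: sum_list_nonneg)

lemma path_between_append:
  "path_between H x \<sigma> y \<Longrightarrow> path_between H y \<tau> z \<Longrightarrow> path_between H x (\<sigma> @ \<tau>) z"
  by (induction H x \<sigma> y rule: path_between.induct) auto

lemma path_between_reverse:
  "path_between H x \<sigma> y \<Longrightarrow> \<exists>\<tau>. path_between H y \<tau> x \<and> path_length \<tau> = path_length \<sigma>"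
proof (induction \<sigma> arbitrary: x)
  case Nil
  then show ?case by (intro exI[of _ "[]"]) auto
next
  case (Cons seg \<sigma>)
  obtain e s t where seg: "seg = (e, s, t)" by (cases seg)
  with Cons obtain \<tau> where \<tau>: "path_between H y \<tau> (edge_point H e t)" "path_length \<tau> = path_length \<sigma>"
    by auto
  have "path_between H (edge_point H e t) [(e, t, s)] x"
    using Cons.prems seg by (auto intro: edge_point_in_points)
  then show ?case
    using path_between_append[OF \<tau>(1)] \<tau>(2) seg by (intro exI[of _ "\<tau> @ [(e, t, s)]"]) auto
qed

lemma path_between_edge:
  assumes "metric_graph H" "e \<in> edges H" "joins H e u v"
  obtains \<sigma> where "path_between H (Vertex u) \<sigma> (Vertex v)" "path_length \<sigma> = len H e"
proof -
  have "path_between H (Vertex (src H e)) [(e, 0, len H e)] (Vertex (tgt H e))"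
    "path_length [(e, 0, len H e)] = len H e"
    using assms metric_graphD[OF assms(1,2)] by (auto simp: edge_point_len)
  then show thesis
    using assms(3) path_between_reverse that unfolding joins_def by metis
qed

lemma gdist_le: "path_between H x \<sigma> y \<Longrightarrow> gdist H x y \<le> path_length \<sigma>"
  unfolding gdist_def
  by (rule cInf_lower) (auto intro!: bdd_belowI[of _ 0] simp: path_length_nonneg)

lemma gdist_ge:
  assumes "path_between H x \<sigma>\<^sub>0 y" "\<And>\<sigma>. path_between H x \<sigma> y \<Longrightarrow> c \<le> path_length \<sigma>"
  shows "c \<le> gdist H x y"
  unfolding gdist_def by (rule cInf_greatest) (use assms in auto)

lemma gdist_nonneg: "path_between H x \<sigma>\<^sub>0 y \<Longrightarrow> 0 \<le> gdist H x y"
  by (erule gdist_ge) (rule path_length_nonneg)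

lemma gdist_refl: "x \<in> points H \<Longrightarrow> gdist H x x = 0"
  using gdist_le[of H x "[]" x] gdist_nonneg[of H x "[]" x] by simp

lemma connected_graph_pathE:
  assumes "connected_graph H" "x \<in> points H" "y \<in> points H"
  obtains \<sigma> where "path_between H x \<sigma> y"
  using assms unfolding connected_graph_def by blast

lemma gdist_commute:
  assumes "connected_graph H" "x \<in> points H" "y \<in> points H"
  shows "gdist H x y = gdist H y x"
proof -
  have "gdist H x y \<le> gdist H y x" if points: "x \<in> points H" "y \<in> points H" for x y
  proof -
    obtain \<sigma>\<^sub>0 where "path_between H y \<sigma>\<^sub>0 x"
      using assms(1) points(2,1) by (rule connected_graph_pathE)
    then show ?thesis
      by (rule gdist_ge) (metis path_between_reverse gdist_le)
  qed
  with assms(2,3) show ?thesis by (intro order.antisym)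
qed

lemma gdist_triangle:
  assumes "connected_graph H" "x \<in> points H" "y \<in> points H" "z \<in> points H"
  shows "gdist H x z \<le> gdist H x y + gdist H y z"
proof -
  obtain \<sigma>\<^sub>0 where path_xy: "path_between H x \<sigma>\<^sub>0 y"
    using assms(1,2,3) by (rule connected_graph_pathE)
  obtain \<tau>\<^sub>0 where path_yz: "path_between H y \<tau>\<^sub>0 z"
    using assms(1,3,4) by (rule connected_graph_pathE)
  have "gdist H x z - path_length \<sigma> \<le> gdist H y z" if "path_between H x \<sigma> y" for \<sigma>
  proof (rule gdist_ge[OF path_yz])
    fix \<tau> assume "path_between H y \<tau> z"
    from gdist_le[OF path_between_append[OF that this]]
    show "gdist H x z - path_length \<sigma> \<le> path_length \<tau>" by simp
  qed
  then have "gdist H x z - gdist H y z \<le> gdist H x y"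
    by (intro gdist_ge[OF path_xy]) (simp add: algebra_simps)
  then show ?thesis by simp
qed

lemmas connected_graph_vertex_pathE = connected_graph_pathE[OF _ Vertex_in_points Vertex_in_points]
lemmas vdist_refl = gdist_refl[OF Vertex_in_points]
lemmas vdist_commute = gdist_commute[OF _ Vertex_in_points Vertex_in_points]
lemmas vdist_triangle = gdist_triangle[OF _ Vertex_in_points Vertex_in_points Vertex_in_points]

lemma gdist_same_edge:
  assumes "e \<in> edges H" "s \<in> {0..len H e}" "t \<in> {0..len H e}"
  shows "gdist H (edge_point H e s) (edge_point H e t) \<le> \<bar>t - s\<bar>"
  using gdist_le[of H "edge_point H e s" "[(e, s, t)]" "edge_point H e t"] assms
    edge_point_in_points[of e H t] by auto

lemma vdist_le_len:
  assumes "metric_graph H" "e \<in> edges H" "joins H e u v"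
  shows "vdist H u v \<le> len H e"
  using path_between_edge[OF assms] gdist_le by metis

lemma vdist_edge:
  assumes H: "metric_graph H" "connected_graph H" and e: "e \<in> edges H" and u: "u \<in> verts H"
  shows "\<bar>vdist H u (tgt H e) - vdist H u (src H e)\<bar> \<le> len H e"
proof -
  have verts: "src H e \<in> verts H" "tgt H e \<in> verts H" using metric_graphD[OF H(1) e] by auto
  have "vdist H u (tgt H e) \<le> vdist H u (src H e) + vdist H (src H e) (tgt H e)"
    "vdist H u (src H e) \<le> vdist H u (tgt H e) + vdist H (tgt H e) (src H e)"
    using u verts by (auto intro!: vdist_triangle[OF H(2)])
  moreover have "vdist H (src H e) (tgt H e) \<le> len H e" "vdist H (tgt H e) (src H e) \<le> len H e"
    using vdist_le_len[OF H(1) e] by (auto simp: joins_def)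
  ultimately show ?thesis by linarith
qed

lemma connected_graph_rootedI:
  assumes H: "metric_graph H"
    and root: "\<And>v. v \<in> verts H \<Longrightarrow> \<exists>\<sigma>. path_between H (Vertex r) \<sigma> (Vertex v)"
  shows "connected_graph H"
proof -
  have "\<exists>\<sigma>. path_between H (Vertex r) \<sigma> x" if x: "x \<in> points H" for x
  proof -
    from x show ?thesis
    proof (cases rule: pointsE)
      case vertex
      then show ?thesis using root by blast
    next
      case (edge e t)
      then have "path_between H (Vertex (src H e)) [(e, 0, t)] x"
        using edge_point_in_points[of e H t] by auto
      then show ?thesis
        using root[OF metric_graphD(1)[OF H edge(1)]] path_between_append by blast
    qed
  qed
  then show ?thesis
    unfolding connected_graph_def using path_between_reverse path_between_append by meson
qed

text \<open>The affine extension of \<open>f\<close> to the edges is 1-Lipschitz along every segment.\<close>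

lemma potential_le_path_length:
  assumes H: "metric_graph H"
    and lip: "\<And>e. e \<in> edges H \<Longrightarrow> \<bar>f (tgt H e) - f (src H e)\<bar> \<le> len H e"
    and path: "path_between H (Vertex u) \<sigma> (Vertex v)"
  shows "f v - f u \<le> path_length \<sigma>"
proof -
  define slope where "slope e = (f (tgt H e) - f (src H e)) / len H e" for e
  define h where "h x = (case x of Vertex w \<Rightarrow> f w | Inner e s \<Rightarrow> f (src H e) + slope e * s)" for x
  have h_edge_point: "h (edge_point H e s) = f (src H e) + slope e * s" if "e \<in> edges H" for e s
    using metric_graphD(3)[OF H that] by (auto simp: h_def slope_def edge_point_def)
  have h_lip: "h (edge_point H e t) - h (edge_point H e s) \<le> \<bar>t - s\<bar>" if "e \<in> edges H" for e s t
  proof -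
    have "\<bar>slope e\<bar> \<le> 1"
      using lip[OF that] metric_graphD(3)[OF H that] by (simp add: slope_def)
    have "h (edge_point H e t) - h (edge_point H e s) = slope e * (t - s)"
      by (simp add: h_edge_point[OF that] algebra_simps)
    also have "\<dots> \<le> \<bar>slope e\<bar> * \<bar>t - s\<bar>"
      by (simp flip: abs_mult)
    also have "\<dots> \<le> \<bar>t - s\<bar>"
      using \<open>\<bar>slope e\<bar> \<le> 1\<close> by (simp add: mult_left_le_one_le)
    finally show ?thesis .
  qed
  have "h y - h x \<le> path_length \<sigma>" if "path_between H x \<sigma> y" for x y
    using that
  proof (induction \<sigma> arbitrary: x)
    case (Cons seg \<sigma>)
    obtain e s t where seg: "seg = (e, s, t)" by (cases seg)
    then have "h y - h (edge_point H e t) \<le> path_length \<sigma>"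
      "h (edge_point H e t) - h x \<le> \<bar>t - s\<bar>"
      using Cons h_lip[of e t s] by auto
    then show ?case by (simp add: seg)
  qed simp
  from this[OF path] show ?thesis by (simp add: h_def)
qed

lemma potential_le_vdist:
  assumes "metric_graph H" "path_between H (Vertex u) \<sigma>\<^sub>0 (Vertex v)"
    and "\<And>e. e \<in> edges H \<Longrightarrow> \<bar>f (tgt H e) - f (src H e)\<bar> \<le> len H e"
  shows "f v - f u \<le> vdist H u v"
  using gdist_ge[OF assms(2)] potential_le_path_length[OF assms(1,3)] by blast

section \<open>Subgraphs\<close>

definition subgraph :: "('v, 'e) mgraph \<Rightarrow> ('v, 'e) mgraph \<Rightarrow> bool" where
  "subgraph H G \<longleftrightarrow> verts H \<subseteq> verts G \<and> edges H \<subseteq> edges G \<and>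
     src H = src G \<and> tgt H = tgt G \<and> len H = len G"

lemma subgraph_eqs:
  assumes "subgraph H G"
  shows "src H = src G" "tgt H = tgt G" "len H = len G"
    "edge_point H = edge_point G" "joins H = joins G"
  using assms by (auto simp: subgraph_def edge_point_def joins_def fun_eq_iff)

lemma subgraph_update_eq:
  "subgraph H G \<Longrightarrow> G\<lparr>verts := V, edges := E\<rparr> = H\<lparr>verts := V, edges := E\<rparr>"
  by (cases G; cases H) (simp add: subgraph_def)

lemma metric_graph_subgraph:
  assumes "metric_graph G" "subgraph H G"
    and "\<And>e. e \<in> edges H \<Longrightarrow> src G e \<in> verts H \<and> tgt G e \<in> verts H"
  shows "metric_graph H"
  using assms by (auto simp: metric_graph_def subgraph_def)

lemma path_between_subgraph:
  assumes "subgraph H G" "path_between H x \<sigma> y"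
  shows "path_between G x \<sigma> y"
  using assms(2)
proof (induction \<sigma> arbitrary: x)
  case Nil
  have "points H \<subseteq> points G"
    using assms(1) unfolding points_def subgraph_eqs[OF assms(1)] by (auto simp: subgraph_def)
  with Nil show ?case by auto
next
  case (Cons seg \<sigma>)
  obtain e s t where "seg = (e, s, t)" by (cases seg)
  with Cons assms(1) show ?case by (auto simp: subgraph_eqs[OF assms(1)]) (auto simp: subgraph_def)
qed

lemma gdist_subgraph:
  assumes "subgraph H G" "connected_graph H" "x \<in> points H" "y \<in> points H"
  shows "gdist G x y \<le> gdist H x y"
proof -
  obtain \<sigma>\<^sub>0 where "path_between H x \<sigma>\<^sub>0 y"
    using assms(2-4) by (rule connected_graph_pathE)
  then show ?thesis
    by (rule gdist_ge) (intro gdist_le path_between_subgraph[OF assms(1)])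
qed

lemma connected_graph_spanning_subgraph:
  assumes "metric_graph G" "subgraph H G" "connected_graph H" "verts H = verts G"
  shows "connected_graph G"
proof (rule connected_graph_rootedI[OF assms(1)])
  fix v assume "v \<in> verts G"
  moreover from this have "(SOME r. r \<in> verts G) \<in> verts G" by (rule someI)
  ultimately obtain \<sigma> where "path_between H (Vertex (SOME r. r \<in> verts G)) \<sigma> (Vertex v)"
    using assms(3,4) connected_graph_vertex_pathE by metis
  then show "\<exists>\<sigma>. path_between G (Vertex (SOME r. r \<in> verts G)) \<sigma> (Vertex v)"
    using path_between_subgraph[OF assms(2)] by blast
qed

lemma finite_subgraphs:
  assumes "finite (verts G)" "finite (edges G)"
  shows "finite {H. subgraph H G}"
proof (rule finite_surj)
  show "finite (Pow (verts G) \<times> Pow (edges G))" using assms by simp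
  show "{H. subgraph H G} \<subseteq> (\<lambda>(V, E). G\<lparr>verts := V, edges := E\<rparr>) ` (Pow (verts G) \<times> Pow (edges G))"
  proof
    fix H assume "H \<in> {H. subgraph H G}"
    then show "H \<in> (\<lambda>(V, E). G\<lparr>verts := V, edges := E\<rparr>) ` (Pow (verts G) \<times> Pow (edges G))"
      using subgraph_update_eq[of H G "edges H" "verts H"]
      by (intro image_eqI[of _ _ "(verts H, edges H)"]) (auto simp: subgraph_def)
  qed
qed

section \<open>Walks along edges\<close>

fun walk :: "('v, 'e) mgraph \<Rightarrow> 'v \<Rightarrow> ('e \<times> 'v) list \<Rightarrow> 'v \<Rightarrow> bool" where
  "walk H u [] v \<longleftrightarrow> u \<in> verts H \<and> u = v"
| "walk H u ((e, w) # xs) v \<longleftrightarrow> u \<in> verts H \<and> e \<in> edges H \<and> joins H e u w \<and> walk H w xs v"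

abbreviation walk_edges :: "('e \<times> 'v) list \<Rightarrow> 'e list" where
  "walk_edges \<equiv> map fst"

abbreviation walk_verts :: "'v \<Rightarrow> ('e \<times> 'v) list \<Rightarrow> 'v list" where
  "walk_verts u xs \<equiv> u # map snd xs"

definition walk_length :: "('v, 'e) mgraph \<Rightarrow> ('e \<times> 'v) list \<Rightarrow> real" where
  "walk_length H xs = sum_list (map (len H) (walk_edges xs))"

definition simple_walk :: "('v, 'e) mgraph \<Rightarrow> 'v \<Rightarrow> ('e \<times> 'v) list \<Rightarrow> 'v \<Rightarrow> bool" where
  "simple_walk H u xs v \<longleftrightarrow> walk H u xs v \<and> distinct (walk_verts u xs)"

lemma walk_induct [consumes 1, case_names Nil Cons]:
  assumes "walk H u xs v"
    and "v \<in> verts H \<Longrightarrow> P v []"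
    and "\<And>u e w xs. u \<in> verts H \<Longrightarrow> e \<in> edges H \<Longrightarrow> joins H e u w \<Longrightarrow> walk H w xs v \<Longrightarrow>
      P w xs \<Longrightarrow> P u ((e, w) # xs)"
  shows "P u xs"
  using assms by (induction xs arbitrary: u) auto

lemma simple_walk_Cons:
  "simple_walk H u ((e, w) # xs) v \<longleftrightarrow>
     u \<in> verts H \<and> e \<in> edges H \<and> joins H e u w \<and> u \<notin> set (walk_verts w xs) \<and> simple_walk H w xs v"
  by (auto simp: simple_walk_def)

lemma walk_length_Nil [simp]: "walk_length H [] = 0"
  by (simp add: walk_length_def)

lemma walk_length_Cons [simp]: "walk_length H ((e, w) # xs) = len H e + walk_length H xs"
  by (simp add: walk_length_def)

lemma walk_length_append [simp]: "walk_length H (xs @ ys) = walk_length H xs + walk_length H ys"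
  by (simp add: walk_length_def)

lemma walk_length_subgraph: "subgraph H G \<Longrightarrow> walk_length H = walk_length G"
  by (simp add: walk_length_def subgraph_eqs fun_eq_iff)

lemma walk_length_nonneg: "walk H u xs v \<Longrightarrow> metric_graph H \<Longrightarrow> 0 \<le> walk_length H xs"
  by (induction rule: walk_induct) (auto dest: metric_graphD(3))

lemma walk_ends_in_verts: "walk H u xs v \<Longrightarrow> u \<in> verts H \<and> v \<in> verts H"
  by (induction rule: walk_induct) auto

lemma walk_append: "walk H u (xs @ ys) v \<longleftrightarrow> (\<exists>w. walk H u xs w \<and> walk H w ys v)"
proof (induction xs arbitrary: u)
  case Nil
  then show ?case by (cases ys) auto
qed auto

lemma walk_iff_nth:
  "walk H u xs v \<longleftrightarrow> set (walk_verts u xs) \<subseteq> verts H \<and> set (walk_edges xs) \<subseteq> edges H \<and>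
     (\<forall>i < length xs. joins H (walk_edges xs ! i) (walk_verts u xs ! i) (walk_verts u xs ! Suc i)) \<and>
     last (walk_verts u xs) = v"
proof (induction xs arbitrary: u)
  case (Cons x xs)
  obtain e w where "x = (e, w)" by (cases x)
  with Cons show ?case by (auto simp: All_less_Suc2)
qed auto

lemma walk_subgraph_iff:
  assumes "subgraph H G"
  shows "walk H u xs v \<longleftrightarrow>
    walk G u xs v \<and> set (walk_verts u xs) \<subseteq> verts H \<and> set (walk_edges xs) \<subseteq> edges H"
  using assms unfolding walk_iff_nth subgraph_eqs(5)[OF assms] by (auto simp: subgraph_def)

lemma walk_last_in_verts: "walk H u xs v \<Longrightarrow> v \<in> set (walk_verts u xs)"
  using last_in_set[of "walk_verts u xs"] by (simp only: walk_iff_nth) simp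

lemma walk_edge_ends:
  "walk H u xs v \<Longrightarrow> e \<in> set (walk_edges xs) \<Longrightarrow>
     src H e \<in> set (walk_verts u xs) \<and> tgt H e \<in> set (walk_verts u xs)"
proof (induction rule: walk_induct)
  case (Cons u e' w xs)
  then show ?case by (cases "e = e'") (auto simp: joins_def)
qed simp

lemma walk_avoids_vertex_edges:
  "walk H w xs v \<Longrightarrow> u \<notin> set (walk_verts w xs) \<Longrightarrow> joins H e u w' \<Longrightarrow> e \<notin> set (walk_edges xs)"
  using walk_edge_ends[of H w xs v e] by (auto simp: joins_def)

lemma walk_splitE:
  assumes "walk H u xs v" "w \<in> set (walk_verts u xs)"
  obtains ys zs where "xs = ys @ zs" "walk H u ys w" "walk H w zs v"
proof (cases "w = u")
  case True
  then show thesis using assms(1) that[of "[]" xs] by (cases xs) auto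
next
  case False
  then obtain e where "(e, w) \<in> set xs" using assms(2) by auto
  then obtain ys zs where xs: "xs = ys @ [(e, w)] @ zs" by (auto dest: split_list)
  with assms(1) have "walk H u (ys @ [(e, w)]) w" "walk H w zs v"
    by (auto simp: walk_append dest: walk_ends_in_verts)
  with xs show thesis using that[of "ys @ [(e, w)]" zs] by simp
qed

lemma walk_reverse:
  "walk H u xs v \<Longrightarrow> \<exists>ys. walk H v ys u \<and>
     walk_edges ys = rev (walk_edges xs) \<and> walk_verts v ys = rev (walk_verts u xs)"
proof (induction rule: walk_induct)
  case Nil
  then show ?case by (intro exI[of _ "[]"]) auto
next
  case (Cons u e w xs)
  then obtain ys where "walk H v ys w" "walk_edges ys = rev (walk_edges xs)"
    "walk_verts v ys = rev (walk_verts w xs)"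
    by auto
  moreover have "walk H w [(e, u)] u"
    using Cons.hyps by (auto simp: joins_def dest: walk_ends_in_verts)
  ultimately show ?case
    by (intro exI[of _ "ys @ [(e, u)]"]) (auto simp: walk_append)
qed

lemma simple_walk_reverse:
  assumes "simple_walk H u xs v"
  obtains ys where "simple_walk H v ys u"
    "set (walk_edges ys) = set (walk_edges xs)" "set (walk_verts v ys) = set (walk_verts u xs)"
proof -
  obtain ys where ys: "walk H v ys u" "walk_edges ys = rev (walk_edges xs)"
    "walk_verts v ys = rev (walk_verts u xs)"
    using assms walk_reverse unfolding simple_walk_def by metis
  moreover have "distinct (walk_verts v ys)"
    using assms unfolding ys(3) simple_walk_def by simp
  ultimately show thesis
    using that by (metis set_rev simple_walk_def)
qed

lemma simple_walk_distinct_edges: "simple_walk H u xs v \<Longrightarrow> distinct (walk_edges xs)"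
proof (induction xs arbitrary: u)
  case (Cons x xs)
  obtain e w where x: "x = (e, w)" by (cases x)
  with Cons.prems have "simple_walk H w xs v" "joins H e u w" "u \<notin> set (walk_verts w xs)"
    by (auto simp: simple_walk_Cons)
  then have "e \<notin> set (walk_edges xs)" "distinct (walk_edges xs)"
    using walk_avoids_vertex_edges[of H w xs v u] Cons.IH[of w] by (auto simp: simple_walk_def)
  then show ?case by (simp add: x)
qed simp

lemma simple_walk_of_walk:
  assumes H: "metric_graph H" and "walk H u xs v"
  shows "\<exists>ys. simple_walk H u ys v \<and> walk_length H ys \<le> walk_length H xs"
  using assms(2)
proof (induction rule: walk_induct)
  case Nil
  then show ?case by (intro exI[of _ "[]"]) (auto simp: simple_walk_def)
next
  case (Cons u e w xs)
  then obtain ys where ys: "simple_walk H w ys v" "walk_length H ys \<le> walk_length H xs" by blast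
  show ?case
  proof (cases "u \<in> set (walk_verts w ys)")
    case True
    then obtain ys\<^sub>1 ys\<^sub>2 where split: "ys = ys\<^sub>1 @ ys\<^sub>2" "walk H w ys\<^sub>1 u" "walk H u ys\<^sub>2 v"
      using ys(1) walk_splitE unfolding simple_walk_def by metis
    then have "simple_walk H u ys\<^sub>2 v"
      using ys(1) walk_last_in_verts[OF split(2)] by (auto simp: simple_walk_def)
    moreover have "walk_length H ys\<^sub>2 \<le> walk_length H ((e, w) # xs)"
      using ys(2) split walk_length_nonneg[OF split(2) H] metric_graphD(3)[OF H Cons.hyps(2)] by simp
    ultimately show ?thesis by blast
  next
    case False
    then have "simple_walk H u ((e, w) # ys) v"
      using ys(1) Cons.hyps by (auto simp: simple_walk_Cons)
    then show ?thesis using ys(2) by fastforce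
  qed
qed

lemma simple_walk_unique:
  assumes "simple_walk H u xs v" "simple_walk H u ys v" "set (walk_edges ys) \<subseteq> set (walk_edges xs)"
  shows "ys = xs"
  using assms
proof (induction xs arbitrary: u ys)
  case Nil
  then show ?case by simp
next
  case (Cons x xs)
  obtain e w where x: "x = (e, w)" by (cases x)
  have xs: "simple_walk H w xs v" "joins H e u w" and u: "u \<notin> set (walk_verts w xs)"
    using Cons.prems(1) by (simp_all add: simple_walk_Cons x)
  have "u \<noteq> v"
    using u xs(1) walk_last_in_verts unfolding simple_walk_def by metis
  then have "ys \<noteq> []" using Cons.prems(2) by (auto simp: simple_walk_def)
  then obtain e' w' ys' where ys: "ys = (e', w') # ys'" by (metis list.exhaust surj_pair)
  have ys': "simple_walk H w' ys' v" "joins H e' u w'" and u': "u \<notin> set (walk_verts w' ys')"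
    using Cons.prems(2) by (simp_all add: simple_walk_Cons ys)
  have "e' \<notin> set (walk_edges xs)"
    using walk_avoids_vertex_edges[of H w xs v u] xs(1) u ys'(2) by (metis simple_walk_def)
  then have "e' = e" using Cons.prems(3) ys x by auto
  then have "w' = w" using xs(2) ys'(2) by (auto simp: joins_def)
  have "e \<notin> set (walk_edges ys')"
    using walk_avoids_vertex_edges[of H w' ys' v u] ys'(1) u' xs(2) by (metis simple_walk_def)
  then have "set (walk_edges ys') \<subseteq> set (walk_edges xs)" using Cons.prems(3) ys x by auto
  then show ?case using Cons.IH[OF xs(1)] ys'(1) ys x \<open>e' = e\<close> \<open>w' = w\<close> by simp
qed

lemma walk_path:
  assumes H: "metric_graph H" and "walk H u xs v"
  shows "\<exists>\<sigma>. path_between H (Vertex u) \<sigma> (Vertex v) \<and> path_length \<sigma> = walk_length H xs"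
  using assms(2)
proof (induction rule: walk_induct)
  case Nil
  then show ?case by (intro exI[of _ "[]"]) auto
next
  case (Cons u e w xs)
  then obtain \<sigma> where \<sigma>: "path_between H (Vertex w) \<sigma> (Vertex v)" "path_length \<sigma> = walk_length H xs"
    by blast
  obtain \<tau> where \<tau>: "path_between H (Vertex u) \<tau> (Vertex w)" "path_length \<tau> = len H e"
    using H Cons.hyps(2,3) by (rule path_between_edge)
  show ?case
    using path_between_append[OF \<tau>(1) \<sigma>(1)] \<tau>(2) \<sigma>(2) by (intro exI[of _ "\<tau> @ \<sigma>"]) auto
qed

lemma vdist_le_walk_length: "metric_graph H \<Longrightarrow> walk H u xs v \<Longrightarrow> vdist H u v \<le> walk_length H xs"
  using walk_path gdist_le by metis

lemma connected_graph_spanning_walk: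
  assumes H: "metric_graph H" and xs: "walk H u xs v" "verts H \<subseteq> set (walk_verts u xs)"
  shows "connected_graph H"
proof (rule connected_graph_rootedI[OF H])
  fix w assume "w \<in> verts H"
  with xs(2) have "w \<in> set (walk_verts u xs)" by blast
  then obtain ys where "walk H u ys w" by (rule walk_splitE[OF xs(1)])
  then show "\<exists>\<sigma>. path_between H (Vertex u) \<sigma> (Vertex w)" using walk_path[OF H] by blast
qed

text \<open>The truncation at \<open>c\<close> avoids the junk value \<open>Inf {}\<close> at vertices that no walk from \<open>u\<close> reaches.\<close>

definition truncated_walk_dist :: "('v, 'e) mgraph \<Rightarrow> real \<Rightarrow> 'v \<Rightarrow> 'v \<Rightarrow> real" where
  "truncated_walk_dist H c u v = Inf (insert c {walk_length H xs | xs. walk H u xs v})"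

lemma truncated_walk_dist_le:
  assumes "metric_graph H"
  shows "truncated_walk_dist H c u v \<le> c"
    and "walk H u xs v \<Longrightarrow> truncated_walk_dist H c u v \<le> walk_length H xs"
proof -
  have "bdd_below (insert c {walk_length H xs | xs. walk H u xs v})"
    by (rule bdd_belowI[of _ "min c 0"]) (auto simp: min.coboundedI2 walk_length_nonneg assms)
  then show "truncated_walk_dist H c u v \<le> c"
    and "walk H u xs v \<Longrightarrow> truncated_walk_dist H c u v \<le> walk_length H xs"
    unfolding truncated_walk_dist_def by (auto intro: cInf_lower)
qed

lemma truncated_walk_dist_ge:
  "b \<le> c \<Longrightarrow> (\<And>xs. walk H u xs v \<Longrightarrow> b \<le> walk_length H xs) \<Longrightarrow> b \<le> truncated_walk_dist H c u v"
  unfolding truncated_walk_dist_def by (rule cInf_greatest) auto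

lemma truncated_walk_dist_step:
  assumes H: "metric_graph H" and e: "e \<in> edges H" "joins H e v w"
  shows "truncated_walk_dist H c u w \<le> truncated_walk_dist H c u v + len H e"
proof -
  have "truncated_walk_dist H c u w - len H e \<le> truncated_walk_dist H c u v"
  proof (rule truncated_walk_dist_ge)
    show "truncated_walk_dist H c u w - len H e \<le> c"
      using truncated_walk_dist_le(1)[OF H, of c u w] metric_graphD(3)[OF H e(1)] by simp
    fix xs assume "walk H u xs v"
    then have "walk H u (xs @ [(e, w)]) w"
      using e metric_graphD[OF H e(1)] by (auto simp: walk_append joins_def)
    from truncated_walk_dist_le(2)[OF H this]
    show "truncated_walk_dist H c u w - len H e \<le> walk_length H xs" by (simp add: diff_le_eq)
  qed
  then show ?thesis by simp
qed

lemma walk_length_bound_le_vdist: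
  assumes H: "metric_graph H" "connected_graph H" and uv: "u \<in> verts H" "v \<in> verts H"
    and bound: "\<And>xs. walk H u xs v \<Longrightarrow> c \<le> walk_length H xs"
  shows "c \<le> vdist H u v"
proof -
  let ?f = "truncated_walk_dist H c u"
  obtain \<sigma>\<^sub>0 where "path_between H (Vertex u) \<sigma>\<^sub>0 (Vertex v)"
    using H(2) uv by (rule connected_graph_vertex_pathE)
  moreover have "\<bar>?f (tgt H e) - ?f (src H e)\<bar> \<le> len H e" if "e \<in> edges H" for e
    using truncated_walk_dist_step[OF H(1) that, of "src H e" "tgt H e" c u]
      truncated_walk_dist_step[OF H(1) that, of "tgt H e" "src H e" c u]
    by (simp add: joins_def abs_le_iff)
  ultimately have "?f v - ?f u \<le> vdist H u v"
    using H(1) by (intro potential_le_vdist)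
  moreover have "?f u \<le> 0"
    using truncated_walk_dist_le(2)[OF H(1), of u "[]" u c] uv(1) by simp
  moreover have "c \<le> ?f v"
    using bound by (intro truncated_walk_dist_ge) auto
  ultimately show ?thesis by simp
qed

section \<open>Cycles through an edge\<close>

definition cycle_seq :: "('v, 'e) mgraph \<Rightarrow> 'v list \<Rightarrow> 'e list \<Rightarrow> bool" where
  "cycle_seq G vs es \<longleftrightarrow> es \<noteq> [] \<and> length vs = length es \<and> distinct vs \<and> distinct es \<and>
     set vs \<subseteq> verts G \<and> set es \<subseteq> edges G \<and>
     (\<forall>i < length es. joins G (es ! i) (vs ! i) (vs ! (Suc i mod length es)))"

definition delete_edge :: "('v, 'e) mgraph \<Rightarrow> 'e \<Rightarrow> ('v, 'e) mgraph" where
  "delete_edge G a = G\<lparr>edges := edges G - {a}\<rparr>"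

definition close_walk :: "('v, 'e) mgraph \<Rightarrow> 'e \<Rightarrow> ('e \<times> 'v) list \<Rightarrow> ('v, 'e) mgraph" where
  "close_walk G a xs =
     G\<lparr>verts := set (walk_verts (tgt G a) xs), edges := insert a (set (walk_edges xs))\<rparr>"

lemma cycle_iff_cycle_seq:
  "cycle G D \<longleftrightarrow> (\<exists>vs es. cycle_seq G vs es \<and> D = G\<lparr>verts := set vs, edges := set es\<rparr>)"
  by (auto simp: cycle_def cycle_seq_def)

lemma cycle_seq_rotate:
  assumes "cycle_seq G vs es"
  shows "cycle_seq G (rotate n vs) (rotate n es)"
proof -
  let ?N = "length es"
  have N: "?N > 0" "length vs = ?N" using assms by (auto simp: cycle_seq_def)
  have "joins G (rotate n es ! i) (rotate n vs ! i) (rotate n vs ! (Suc i mod ?N))"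
    if "i < ?N" for i
  proof -
    have "joins G (es ! ((n + i) mod ?N)) (vs ! ((n + i) mod ?N)) (vs ! (Suc ((n + i) mod ?N) mod ?N))"
      using assms N by (simp add: cycle_seq_def)
    moreover have "rotate n es ! i = es ! ((n + i) mod ?N)" "rotate n vs ! i = vs ! ((n + i) mod ?N)"
      "rotate n vs ! (Suc i mod ?N) = vs ! (Suc ((n + i) mod ?N) mod ?N)"
      using that N by (simp_all add: nth_rotate mod_simps)
    ultimately show ?thesis by simp
  qed
  then show ?thesis using assms by (simp add: cycle_seq_def)
qed

lemma cycle_subgraph: "cycle G D \<Longrightarrow> subgraph D G"
  by (auto simp: cycle_def subgraph_def)

lemma cycle_in_subgraph_iff:
  assumes "subgraph K G"
  shows "cycle K D \<longleftrightarrow> cycle G D \<and> subgraph D K"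
proof -
  have "cycle_seq K vs es \<longleftrightarrow> cycle_seq G vs es \<and> set vs \<subseteq> verts K \<and> set es \<subseteq> edges K" for vs es
    using assms unfolding cycle_seq_def subgraph_eqs(5)[OF assms] by (auto simp: subgraph_def)
  then show ?thesis
    unfolding cycle_iff_cycle_seq subgraph_update_eq[OF assms] by (auto simp: subgraph_def) blast
qed

lemma finite_cycle: "cycle G D \<Longrightarrow> finite (verts D)" "cycle G D \<Longrightarrow> finite (edges D)"
  by (auto simp: cycle_def)

lemma delete_edge_simps [simp]:
  "verts (delete_edge G a) = verts G" "edges (delete_edge G a) = edges G - {a}"
  "src (delete_edge G a) = src G" "tgt (delete_edge G a) = tgt G" "len (delete_edge G a) = len G"
  by (simp_all add: delete_edge_def)

lemma subgraph_delete_edge: "subgraph (delete_edge G a) G"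
  by (auto simp: delete_edge_def subgraph_def)

lemma subgraph_delete_edge_mono: "subgraph H G \<Longrightarrow> subgraph (delete_edge H a) (delete_edge G a)"
  by (auto simp: delete_edge_def subgraph_def)

lemma metric_graph_delete_edge: "metric_graph G \<Longrightarrow> metric_graph (delete_edge G a)"
  by (auto simp: delete_edge_def metric_graph_def)

lemma simple_walk_delete_edge:
  "simple_walk (delete_edge G a) u xs v \<longleftrightarrow> simple_walk G u xs v \<and> a \<notin> set (walk_edges xs)"
  unfolding simple_walk_def walk_subgraph_iff[OF subgraph_delete_edge] by (auto simp: walk_iff_nth)

lemma cycle_seq_iff_simple_walk:
  "cycle_seq G (walk_verts u xs) (walk_edges xs @ [a]) \<longleftrightarrow>
     (\<exists>v. simple_walk (delete_edge G a) u xs v \<and> a \<in> edges G \<and> joins G a v u)"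
proof -
  let ?vs = "walk_verts u xs" and ?es = "walk_edges xs @ [a]"
  have "joins G (?es ! i) (?vs ! i) (?vs ! (Suc i mod length ?es)) \<longleftrightarrow>
      (if i < length xs then joins G (walk_edges xs ! i) (?vs ! i) (?vs ! Suc i)
       else joins G a (last ?vs) u)" if "i < Suc (length xs)" for i
  proof (cases "i < length xs")
    case True
    then have "Suc i mod length ?es = Suc i" by simp
    with True show ?thesis by (simp add: nth_append)
  next
    case False
    with that have "i = length xs" by simp
    then show ?thesis by (simp add: last_conv_nth nth_append)
  qed
  then have "(\<forall>i < length ?es. joins G (?es ! i) (?vs ! i) (?vs ! (Suc i mod length ?es))) \<longleftrightarrow>
      (\<forall>i < length xs. joins G (walk_edges xs ! i) (?vs ! i) (?vs ! Suc i)) \<and> joins G a (last ?vs) u"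
    by (auto simp: less_Suc_eq)
  then show ?thesis
    using simple_walk_distinct_edges[of G u xs "last ?vs"]
    unfolding cycle_seq_def simple_walk_delete_edge simple_walk_def[of G] walk_iff_nth by auto
qed

lemma cycle_close_walk:
  assumes "a \<in> edges G" "simple_walk (delete_edge G a) (tgt G a) xs (src G a)"
  shows "cycle G (close_walk G a xs)"
proof -
  have "cycle_seq G (walk_verts (tgt G a) xs) (walk_edges xs @ [a])"
    using assms by (auto simp: cycle_seq_iff_simple_walk joins_def)
  then show ?thesis
    unfolding cycle_iff_cycle_seq close_walk_def by fastforce
qed

lemma cycle_open_at_edgeE:
  assumes "cycle G D" "a \<in> edges D"
  obtains u xs v where "simple_walk (delete_edge G a) u xs v" "joins G a v u"
    "D = G\<lparr>verts := set (walk_verts u xs), edges := insert a (set (walk_edges xs))\<rparr>"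
proof -
  obtain vs es where D: "cycle_seq G vs es" "D = G\<lparr>verts := set vs, edges := set es\<rparr>"
    using assms(1) cycle_iff_cycle_seq by metis
  obtain i where i: "i < length es" "es ! i = a"
    using assms(2) D(2) by (auto simp: in_set_conv_nth)
  define us fs where "us = rotate (Suc i) vs" and "fs = rotate (Suc i) es"
  have rot: "cycle_seq G us fs" unfolding us_def fs_def using cycle_seq_rotate[OF D(1)] .
  then have "fs \<noteq> []" "length us = length fs" by (auto simp: cycle_seq_def)
  then obtain u ws where us: "us = u # ws" "length ws = length (butlast fs)"
    by (cases us) auto
  have "Suc i + (length es - 1) = i + length es" using i(1) by simp
  then have "last fs = a"
    using \<open>fs \<noteq> []\<close> i by (simp add: fs_def last_conv_nth nth_rotate del: rotate_Suc)
  with \<open>fs \<noteq> []\<close> have "fs = butlast fs @ [a]" by (metis append_butlast_last_id)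
  with us obtain ys where ys: "us = walk_verts u ys" "fs = walk_edges ys @ [a]"
    by (metis map_fst_zip map_snd_zip)
  then obtain v where "simple_walk (delete_edge G a) u ys v" "joins G a v u"
    using rot by (auto simp: cycle_seq_iff_simple_walk)
  moreover have "D = G\<lparr>verts := set (walk_verts u ys), edges := insert a (set (walk_edges ys))\<rparr>"
    unfolding D(2) using arg_cong[OF ys(1), of set] arg_cong[OF ys(2), of set]
    by (simp add: us_def fs_def)
  ultimately show thesis by (rule that)
qed

lemma cycle_cutE:
  assumes "cycle G D" "a \<in> edges D"
  obtains xs where "simple_walk (delete_edge G a) (tgt G a) xs (src G a)" "D = close_walk G a xs"
proof -
  obtain u ys v where walk: "simple_walk (delete_edge G a) u ys v" "joins G a v u"
    and D_eq: "D = G\<lparr>verts := set (walk_verts u ys), edges := insert a (set (walk_edges ys))\<rparr>"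
    using assms by (rule cycle_open_at_edgeE)
  show thesis
  proof (cases "u = tgt G a")
    case True
    then have "v = src G a" using walk(2) by (auto simp: joins_def)
    with True walk(1) D_eq show thesis using that[of ys] by (simp add: close_walk_def)
  next
    case False
    then have "u = src G a" "v = tgt G a" using walk(2) by (auto simp: joins_def)
    moreover obtain xs where "simple_walk (delete_edge G a) v xs u"
      "set (walk_edges xs) = set (walk_edges ys)" "set (walk_verts v xs) = set (walk_verts u ys)"
      using simple_walk_reverse[OF walk(1)] by blast
    ultimately show thesis using that[of xs] D_eq unfolding close_walk_def by simp
  qed
qed

lemma total_length_close_walk:
  assumes "simple_walk (delete_edge G a) u xs v"
  shows "total_length (close_walk G a xs) = len G a + walk_length G xs"
proof -
  have "distinct (walk_edges xs)" "a \<notin> set (walk_edges xs)"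
    using assms simple_walk_distinct_edges by (auto simp: simple_walk_delete_edge)
  moreover from this(1) have "sum (len G) (set (walk_edges xs)) = walk_length G xs"
    unfolding walk_length_def by (rule sum.distinct_set_conv_list)
  ultimately show ?thesis by (simp add: total_length_def close_walk_def)
qed

lemma walk_close_walk:
  assumes "simple_walk (delete_edge G a) (tgt G a) xs (src G a)"
  shows "walk (delete_edge (close_walk G a xs) a) (tgt G a) xs (src G a)"
proof -
  have "walk G (tgt G a) xs (src G a)" "a \<notin> set (walk_edges xs)"
    using assms by (auto simp: simple_walk_delete_edge simple_walk_def[of G])
  then show ?thesis
    unfolding walk_iff_nth by (auto simp: delete_edge_def close_walk_def joins_def)
qed

lemma cycle_spanning_walkE:
  assumes "cycle G D" "a \<in> edges D"
  obtains xs where "walk (delete_edge D a) (tgt G a) xs (src G a)"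
    "verts D = set (walk_verts (tgt G a) xs)" "total_length D = len G a + walk_length G xs"
proof -
  obtain xs where xs: "simple_walk (delete_edge G a) (tgt G a) xs (src G a)" "D = close_walk G a xs"
    using assms by (rule cycle_cutE)
  show thesis
    using that[of xs] walk_close_walk[OF xs(1)] total_length_close_walk[OF xs(1)] xs(2)
    by (simp add: close_walk_def)
qed

lemma cycle_edges_nonempty: "cycle G D \<Longrightarrow> edges D \<noteq> {}"
  by (auto simp: cycle_def)

lemma cycle_vertex_incident_edge:
  assumes "cycle G D" "v \<in> verts D"
  shows "\<exists>e \<in> edges D. v = src G e \<or> v = tgt G e"
proof -
  obtain vs es where D: "cycle_seq G vs es" "D = G\<lparr>verts := set vs, edges := set es\<rparr>"
    using assms(1) cycle_iff_cycle_seq by metis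
  with assms(2) obtain i where "i < length es" "v = vs ! i"
    by (auto simp: cycle_seq_def in_set_conv_nth)
  with D show ?thesis
    by (intro bexI[of _ "es ! i"]) (auto simp: cycle_seq_def joins_def)
qed

lemma cycle_point_on_edge:
  assumes G: "metric_graph G" and D: "cycle G D" "x \<in> points D"
  obtains e t where "e \<in> edges D" "t \<in> {0..len G e}" "x = edge_point G e t"
proof -
  note sub = cycle_subgraph[OF D(1)]
  from D(2) show thesis
  proof (cases rule: pointsE)
    case (vertex v)
    then obtain e where e: "e \<in> edges D" "v = src G e \<or> v = tgt G e"
      using cycle_vertex_incident_edge[OF D(1)] by blast
    then have eG: "e \<in> edges G" using sub by (auto simp: subgraph_def)
    then have "x = edge_point G e 0 \<or> x = edge_point G e (len G e)"
      using vertex(2) e(2) edge_point_len[OF G] by auto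
    moreover have "0 \<in> {0..len G e}" "len G e \<in> {0..len G e}"
      using metric_graphD(3)[OF G eG] by auto
    ultimately show thesis using that e(1) by blast
  next
    case (edge e t)
    then show thesis using that by (simp add: subgraph_eqs[OF sub])
  qed
qed

lemma metric_graph_cycle:
  assumes "metric_graph G" "cycle G D"
  shows "metric_graph D"
proof (rule metric_graph_subgraph[OF assms(1) cycle_subgraph[OF assms(2)]])
  fix e assume "e \<in> edges D"
  with assms(2) obtain xs where "simple_walk (delete_edge G e) (tgt G e) xs (src G e)"
    "D = close_walk G e xs"
    by (rule cycle_cutE)
  then show "src G e \<in> verts D \<and> tgt G e \<in> verts D"
    using walk_last_in_verts[of "delete_edge G e" "tgt G e" xs "src G e"]
    by (simp add: simple_walk_def close_walk_def)
qed

lemma connected_graph_cycle_delete_edge: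
  assumes "metric_graph G" "cycle G D" "a \<in> edges D"
  shows "connected_graph (delete_edge D a)"
proof -
  obtain xs where "walk (delete_edge D a) (tgt G a) xs (src G a)"
    "verts D = set (walk_verts (tgt G a) xs)"
    using assms(2,3) by (rule cycle_spanning_walkE)
  moreover have "metric_graph (delete_edge D a)"
    using metric_graph_delete_edge[OF metric_graph_cycle[OF assms(1,2)]] .
  ultimately show ?thesis
    using connected_graph_spanning_walk[of "delete_edge D a" "tgt G a" xs "src G a"] by simp
qed

lemma connected_graph_cycle:
  assumes "metric_graph G" "cycle G D"
  shows "connected_graph D"
proof -
  obtain a where "a \<in> edges D" using cycle_edges_nonempty[OF assms(2)] by blast
  with assms show ?thesis
    using connected_graph_spanning_subgraph[OF metric_graph_cycle[OF assms] subgraph_delete_edge]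
      connected_graph_cycle_delete_edge by fastforce
qed

section \<open>Shortest cycles through an edge are isometric\<close>

lemma geodesic_middle_segment:
  assumes H: "metric_graph H" "connected_graph H"
    and walks: "walk H u xs p" "walk H p ys q" "walk H q zs v"
    and geodesic: "walk_length H (xs @ ys @ zs) \<le> vdist H u v"
  shows "walk_length H ys \<le> vdist H p q"
proof -
  have verts: "u \<in> verts H" "p \<in> verts H" "q \<in> verts H" "v \<in> verts H"
    using walks by (auto dest: walk_ends_in_verts)
  have "walk_length H (xs @ ys @ zs) \<le> vdist H u p + vdist H p q + vdist H q v"
    using geodesic vdist_triangle[OF H(2) verts(1,2,4)] vdist_triangle[OF H(2) verts(2,3,4)]
    by linarith
  also have "\<dots> \<le> walk_length H xs + vdist H p q + walk_length H zs"
    using walks(1,3)[THEN vdist_le_walk_length[OF H(1)]] by simp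
  finally show ?thesis by simp
qed

lemma geodesic_walk_vdist_le:
  assumes H: "metric_graph H" "connected_graph H"
    and P: "metric_graph P" "connected_graph P" "subgraph P H"
    and xs: "walk P u xs v" "walk_length H xs \<le> vdist H u v"
    and pq: "p \<in> set (walk_verts u xs)" "q \<in> set (walk_verts u xs)"
  shows "vdist P p q \<le> vdist H p q"
proof -
  have ordered: "vdist P p q \<le> vdist H p q"
    if "xs = ys @ zs @ ws" "walk P u ys p" "walk P p zs q" "walk P q ws v" for p q ys zs ws
  proof -
    have "vdist P p q \<le> walk_length P zs" using P(1) that(3) by (rule vdist_le_walk_length)
    also have "\<dots> = walk_length H zs" by (simp add: walk_length_subgraph[OF P(3)])
    also have "\<dots> \<le> vdist H p q"
      using that xs(2) geodesic_middle_segment[OF H, of u ys p zs q ws v]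
      by (simp add: walk_subgraph_iff[OF P(3)])
    finally show ?thesis .
  qed
  obtain ys zs where split: "xs = ys @ zs" "walk P u ys p" "walk P p zs v"
    using xs(1) pq(1) by (rule walk_splitE)
  from pq(2) split(1) walk_last_in_verts[OF split(2)]
  consider (after) "q \<in> set (walk_verts p zs)" | (before) "q \<in> set (walk_verts u ys)" by auto
  then show ?thesis
  proof cases
    case after
    with split(3) obtain zs\<^sub>1 zs\<^sub>2 where "zs = zs\<^sub>1 @ zs\<^sub>2" "walk P p zs\<^sub>1 q" "walk P q zs\<^sub>2 v"
      by (rule walk_splitE)
    then show ?thesis using ordered[of ys zs\<^sub>1 zs\<^sub>2 p q] split by simp
  next
    case before
    with split(2) obtain ys\<^sub>1 ys\<^sub>2 where "ys = ys\<^sub>1 @ ys\<^sub>2" "walk P u ys\<^sub>1 q" "walk P q ys\<^sub>2 p"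
      by (rule walk_splitE)
    then have "vdist P q p \<le> vdist H q p" using ordered[of ys\<^sub>1 ys\<^sub>2 zs q p] split by simp
    moreover have "p \<in> verts P" "q \<in> verts P" using xs(1) pq by (auto simp: walk_iff_nth)
    moreover from this have "p \<in> verts H" "q \<in> verts H" using P(3) by (auto simp: subgraph_def)
    ultimately show ?thesis
      using vdist_commute[OF H(2)] vdist_commute[OF P(2)] by metis
  qed
qed

definition shortest_cycle_through :: "('v, 'e) mgraph \<Rightarrow> 'e \<Rightarrow> ('v, 'e) mgraph \<Rightarrow> bool" where
  "shortest_cycle_through K a D \<longleftrightarrow> is_arg_min total_length (\<lambda>D. cycle K D \<and> a \<in> edges D) D"

text \<open>A shortest path in \<open>K\<close> avoids \<open>a\<close> or traverses it once, in one of the two directions.\<close>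

lemma vdist_add_edge_cases:
  assumes K: "metric_graph K" and H: "connected_graph (delete_edge K a)" and a: "a \<in> edges K"
    and pq: "p \<in> verts K" "q \<in> verts K"
  defines "d \<equiv> vdist (delete_edge K a)" and "s \<equiv> src K a" and "t \<equiv> tgt K a"
  obtains (avoiding) "d p q \<le> vdist K p q"
    | (forward) "d p s + len K a + d t q \<le> vdist K p q"
    | (backward) "d p t + len K a + d s q \<le> vdist K p q"
proof -
  let ?H = "delete_edge K a"
  define f where "f w = min (d p w) (min (d p s + len K a + d t w) (d p t + len K a + d s w))" for w
  have mH: "metric_graph ?H" using K by (rule metric_graph_delete_edge)
  have st: "s \<in> verts ?H" "t \<in> verts ?H" using metric_graphD[OF K a] by (auto simp: s_def t_def)
  have nonneg: "0 \<le> d v w" if "v \<in> verts ?H" "w \<in> verts ?H" for v w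
    unfolding d_def using H that by (rule connected_graph_vertex_pathE) (rule gdist_nonneg)
  have lip: "\<bar>f (tgt K e) - f (src K e)\<bar> \<le> len K e" if e: "e \<in> edges K" for e
  proof (cases "e = a")
    case True
    have "d s s = 0" "d t t = 0" using st by (simp_all add: d_def vdist_refl)
    then show ?thesis
      using True nonneg[OF st] nonneg[OF st(2,1)] nonneg[of p s] nonneg[of p t] pq st
        metric_graphD(3)[OF K a]
      by (auto simp: f_def s_def t_def)
  next
    case False
    then have "e \<in> edges ?H" using e by simp
    have "\<bar>d v (tgt K e) - d v (src K e)\<bar> \<le> len K e" if "v \<in> verts K" for v
      using vdist_edge[OF mH H \<open>e \<in> edges ?H\<close>, of v] that by (simp add: d_def)
    from this[OF pq(1)] this[of s] this[of t] st show ?thesis by (auto simp: f_def)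
  qed
  obtain \<sigma>\<^sub>0 where "path_between ?H (Vertex p) \<sigma>\<^sub>0 (Vertex q)"
    using connected_graph_vertex_pathE[OF H] pq by auto
  then have "path_between K (Vertex p) \<sigma>\<^sub>0 (Vertex q)"
    by (rule path_between_subgraph[OF subgraph_delete_edge])
  then have "f q - f p \<le> vdist K p q"
    using lip by (rule potential_le_vdist[OF K])
  moreover have "d p p = 0" using pq(1) by (simp_all add: d_def vdist_refl)
  then have "f p \<le> 0" by (simp add: f_def)
  ultimately show thesis using that unfolding f_def by linarith
qed

lemma shortest_cycle_throughD:
  assumes "shortest_cycle_through K a D"
  shows "cycle K D" "a \<in> edges D"
    and "cycle K D' \<Longrightarrow> a \<in> edges D' \<Longrightarrow> total_length D \<le> total_length D'"
  using assms by (auto simp: shortest_cycle_through_def is_arg_min_linorder)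

lemma ex_shortest_cycle_through:
  assumes "finite (verts K)" "finite (edges K)" "cycle K C" "a \<in> edges C"
  obtains D where "shortest_cycle_through K a D"
proof -
  have "{D. cycle K D \<and> a \<in> edges D} \<subseteq> {D. subgraph D K}" using cycle_subgraph by blast
  then have "finite {D. cycle K D \<and> a \<in> edges D}"
    using finite_subgraphs[OF assms(1,2)] by (rule finite_subset)
  then show thesis
    using ex_is_arg_min_if_finite[of "{D. cycle K D \<and> a \<in> edges D}" total_length] assms(3,4) that
    by (auto simp: shortest_cycle_through_def)
qed

lemma shortest_cycle_through_complement_geodesic:
  assumes K: "metric_graph K" "connected_graph (delete_edge K a)"
    and D: "shortest_cycle_through K a D"
  shows "total_length D - len K a \<le> vdist (delete_edge K a) (tgt K a) (src K a)"
proof (rule walk_length_bound_le_vdist)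
  note D = shortest_cycle_throughD[OF D]
  have a: "a \<in> edges K" using D(2) cycle_subgraph[OF D(1)] by (auto simp: subgraph_def)
  show mH: "metric_graph (delete_edge K a)" using K(1) by (rule metric_graph_delete_edge)
  show "tgt K a \<in> verts (delete_edge K a)" "src K a \<in> verts (delete_edge K a)"
    using metric_graphD[OF K(1) a] by simp_all
  fix xs assume "walk (delete_edge K a) (tgt K a) xs (src K a)"
  then obtain ys where ys: "simple_walk (delete_edge K a) (tgt K a) ys (src K a)"
    "walk_length (delete_edge K a) ys \<le> walk_length (delete_edge K a) xs"
    using simple_walk_of_walk[OF mH] by blast
  have "total_length D \<le> len K a + walk_length K ys"
    using D(3)[OF cycle_close_walk[OF a ys(1)]] total_length_close_walk[OF ys(1)]
    by (simp add: close_walk_def)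
  then show "total_length D - len K a \<le> walk_length (delete_edge K a) xs"
    using ys(2) by (simp add: walk_length_subgraph[OF subgraph_delete_edge])
qed (rule K(2))

lemma shortest_cycle_through_vdist_le_delete_edge:
  assumes K: "metric_graph K" "connected_graph (delete_edge K a)"
    and D: "shortest_cycle_through K a D" and pq: "p \<in> verts D" "q \<in> verts D"
  shows "vdist D p q \<le> vdist (delete_edge K a) p q"
proof -
  let ?H = "delete_edge K a" and ?P = "delete_edge D a"
  note cycle = shortest_cycle_throughD(1,2)[OF D]
  have P: "metric_graph ?P" "connected_graph ?P" "subgraph ?P ?H"
    using metric_graph_delete_edge[OF metric_graph_cycle[OF K(1) cycle(1)]]
      connected_graph_cycle_delete_edge[OF K(1) cycle]
      subgraph_delete_edge_mono[OF cycle_subgraph[OF cycle(1)]] .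
  obtain xs where xs: "walk ?P (tgt K a) xs (src K a)" "verts D = set (walk_verts (tgt K a) xs)"
    "total_length D = len K a + walk_length K xs"
    using cycle by (rule cycle_spanning_walkE)
  have "walk_length ?H xs \<le> vdist ?H (tgt K a) (src K a)"
    using shortest_cycle_through_complement_geodesic[OF K D] xs(3)
    by (simp add: walk_length_subgraph[OF subgraph_delete_edge])
  with pq have "vdist ?P p q \<le> vdist ?H p q"
    unfolding xs(2) by (intro geodesic_walk_vdist_le[OF metric_graph_delete_edge[OF K(1)] K(2) P xs(1)])
  moreover have "vdist D p q \<le> vdist ?P p q"
    using pq by (intro gdist_subgraph[OF subgraph_delete_edge P(2)]) auto
  ultimately show ?thesis by simp
qed

lemma shortest_cycle_through_vdist_le:
  assumes K: "metric_graph K" "connected_graph (delete_edge K a)"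
    and D: "shortest_cycle_through K a D" and pq: "p \<in> verts D" "q \<in> verts D"
  shows "vdist D p q \<le> vdist K p q"
proof -
  note cycle = shortest_cycle_throughD(1,2)[OF D]
  note sub = cycle_subgraph[OF cycle(1)]
  note dist_le = shortest_cycle_through_vdist_le_delete_edge[OF K D]
  note triangle = vdist_triangle[OF connected_graph_cycle[OF K(1) cycle(1)]]
  have mD: "metric_graph D" using K(1) cycle(1) by (rule metric_graph_cycle)
  have ends: "src K a \<in> verts D" "tgt K a \<in> verts D"
    using metric_graphD[OF mD cycle(2)] by (simp_all add: subgraph_eqs[OF sub])
  have across: "vdist D (src K a) (tgt K a) \<le> len K a" "vdist D (tgt K a) (src K a) \<le> len K a"
    using vdist_le_len[OF mD cycle(2)] by (auto simp: subgraph_eqs[OF sub] joins_def)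
  have "a \<in> edges K" "p \<in> verts K" "q \<in> verts K" using pq cycle(2) sub by (auto simp: subgraph_def)
  with K show ?thesis
  proof (cases rule: vdist_add_edge_cases)
    case avoiding
    then show ?thesis using dist_le[OF pq] by simp
  next
    case forward
    then show ?thesis
      using dist_le[OF pq(1) ends(1)] dist_le[OF ends(2) pq(2)] across(1)
        triangle[OF pq(1) ends(1) pq(2)] triangle[OF ends pq(2)] by linarith
  next
    case backward
    then show ?thesis
      using dist_le[OF pq(1) ends(2)] dist_le[OF ends(1) pq(2)] across(2)
        triangle[OF pq(1) ends(2) pq(2)] triangle[OF ends(2,1) pq(2)] by linarith
  qed
qed

section \<open>Density of the shortcut vertices\<close>

definition chords :: "('v, 'e) mgraph \<Rightarrow> ('v, 'e) mgraph \<Rightarrow> real \<Rightarrow> 'e set" where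
  "chords G C m = {e. edge_shortcut G C e \<and> len G e \<le> m}"

definition add_chords :: "('v, 'e) mgraph \<Rightarrow> ('v, 'e) mgraph \<Rightarrow> real \<Rightarrow> ('v, 'e) mgraph" where
  "add_chords G C m = C\<lparr>edges := edges C \<union> chords G C m\<rparr>"

lemma add_chords_simps [simp]:
  "verts (add_chords G C m) = verts C" "edges (add_chords G C m) = edges C \<union> chords G C m"
  by (simp_all add: add_chords_def)

lemma edge_shortcut_iff:
  assumes "metric_graph G"
  shows "edge_shortcut G C e \<longleftrightarrow> e \<in> edges G \<and> src G e \<in> verts C \<and> tgt G e \<in> verts C \<and>
    len G e < vdist C (src G e) (tgt G e)"
  using edge_point_len[OF assms, of e] metric_graphD[OF assms, of e]
  by (auto simp: edge_shortcut_def shortcut_def)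

lemma edge_shortcut_notin_cycle:
  assumes "metric_graph G" "cycle G C" "edge_shortcut G C e"
  shows "e \<notin> edges C"
  using assms vdist_le_len[OF metric_graph_cycle[OF assms(1,2)], of e "src G e" "tgt G e"]
  by (auto simp: edge_shortcut_iff subgraph_eqs[OF cycle_subgraph[OF assms(2)]] joins_def)

lemma edge_shortcut_meets_cycle:
  assumes "metric_graph G" "cycle G C" "edge_shortcut G C e" "edge_point G e t \<in> points C"
  shows "edge_point G e t \<in> {Vertex (src G e), Vertex (tgt G e)}"
  using assms(4) edge_shortcut_notin_cycle[OF assms(1-3)]
  unfolding points_def subgraph_eqs[OF cycle_subgraph[OF assms(2)]]
  by (auto simp: edge_point_def split: if_splits)

lemma edge_shortcut_strict:
  assumes G: "metric_graph G" and C: "cycle G C" and e: "edge_shortcut G C e"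
  shows "strict_shortcut G C [(e, 0, len G e)] (src G e) (tgt G e)"
proof -
  let ?ends = "{Vertex (src G e), Vertex (tgt G e)}" and ?segment = "edge_point G e ` {0..len G e}"
  have eG: "e \<in> edges G" and ends: "src G e \<in> verts C" "tgt G e \<in> verts C"
    using e by (auto simp: edge_shortcut_iff[OF G])
  have len_pos: "0 < len G e" and edge_end: "edge_point G e (len G e) = Vertex (tgt G e)"
    using metric_graphD(3)[OF G eG] edge_point_len[OF G eG] .
  then have image: "path_image G [(e, 0, len G e)] = ?segment"
    and shortcut: "shortcut G C [(e, 0, len G e)] (src G e) (tgt G e)"
    using e metric_graphD[OF G eG] by (auto simp: path_image_def shortcut_def edge_shortcut_iff[OF G])
  have "?ends = edge_point G e ` {0, len G e}"
    by (simp add: edge_end)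
  also have "\<dots> \<subseteq> ?segment"
    using len_pos by (intro image_mono) auto
  finally have "?ends \<subseteq> ?segment" .
  moreover have "?ends \<subseteq> points C" using ends by auto
  moreover have "?segment \<inter> points C \<subseteq> ?ends"
    using edge_shortcut_meets_cycle[OF G C e] by blast
  ultimately show ?thesis
    unfolding strict_shortcut_def image using shortcut by blast
qed

lemma finite_chords:
  assumes "metric_graph G" "locally_finite G" "cycle G C"
  shows "finite (chords G C m)"
proof (rule finite_subset)
  show "chords G C m \<subseteq> (\<Union>v \<in> verts C. {e \<in> edges G. src G e = v \<or> tgt G e = v})"
    by (auto simp: chords_def edge_shortcut_iff[OF assms(1)])
  show "finite (\<Union>v \<in> verts C. {e \<in> edges G. src G e = v \<or> tgt G e = v})"
    using assms(2) finite_cycle(1)[OF assms(3)] cycle_subgraph[OF assms(3)]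
    by (auto simp: locally_finite_def subgraph_def)
qed

lemma subgraph_add_chords:
  assumes "metric_graph G" "cycle G C"
  shows "subgraph (add_chords G C m) G" "subgraph C (add_chords G C m)"
  using cycle_subgraph[OF assms(2)]
  by (auto simp: add_chords_def subgraph_def chords_def edge_shortcut_iff[OF assms(1)])

lemma metric_graph_add_chords:
  assumes G: "metric_graph G" and C: "cycle G C"
  shows "metric_graph (add_chords G C m)"
proof (rule metric_graph_subgraph[OF G subgraph_add_chords(1)[OF assms]])
  fix e assume "e \<in> edges (add_chords G C m)"
  then have "e \<in> edges C \<or> edge_shortcut G C e" by (auto simp: chords_def)
  then show "src G e \<in> verts (add_chords G C m) \<and> tgt G e \<in> verts (add_chords G C m)"
    using metric_graphD[OF metric_graph_cycle[OF assms], of e]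
    by (auto simp: edge_shortcut_iff[OF G] subgraph_eqs[OF cycle_subgraph[OF C]])
qed

lemma connected_graph_add_chords_delete_edge:
  assumes G: "metric_graph G" and C: "cycle G C" "a \<in> edges C"
  shows "connected_graph (delete_edge (add_chords G C m) a)"
proof (rule connected_graph_spanning_subgraph)
  show "metric_graph (delete_edge (add_chords G C m) a)"
    using metric_graph_add_chords[OF G C(1)] by (rule metric_graph_delete_edge)
  show "subgraph (delete_edge C a) (delete_edge (add_chords G C m) a)"
    using subgraph_add_chords(2)[OF G C(1)] by (rule subgraph_delete_edge_mono)
  show "connected_graph (delete_edge C a)"
    using G C by (rule connected_graph_cycle_delete_edge)
qed simp

lemma shortest_cycle_add_chords_total_length_less:
  assumes G: "metric_graph G" "edge_chordal G k m" and C: "cycle G C" "a \<in> edges C"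
    and D: "shortest_cycle_through (add_chords G C m) a D"
  shows "total_length D < k"
proof (rule ccontr)
  let ?K = "add_chords G C m"
  assume "\<not> total_length D < k"
  have sub: "subgraph ?K G" "subgraph C ?K" using G(1) C(1) by (rule subgraph_add_chords)+
  have mK: "metric_graph ?K" using G(1) C(1) by (rule metric_graph_add_chords)
  have DK: "cycle ?K D" using shortest_cycle_throughD(1)[OF D] .
  then have "cycle G D" "verts D \<subseteq> verts C"
    by (auto simp: cycle_in_subgraph_iff[OF sub(1)] subgraph_def)
  with G(2) \<open>\<not> total_length D < k\<close> obtain e where e: "edge_shortcut G D e" "len G e \<le> m"
    by (auto simp: edge_chordal_def not_less)
  let ?p = "src G e" and ?q = "tgt G e"
  have pq: "?p \<in> verts D" "?q \<in> verts D" using e(1) by (auto simp: edge_shortcut_iff[OF G(1)])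
  have "len G e < vdist D ?p ?q" using e(1) by (simp add: edge_shortcut_iff[OF G(1)])
  also have "vdist D ?p ?q \<le> vdist ?K ?p ?q"
    using mK connected_graph_add_chords_delete_edge[OF G(1) C] D pq
    by (rule shortest_cycle_through_vdist_le)
  finally have "len G e < vdist ?K ?p ?q" .
  also have "\<dots> \<le> vdist C ?p ?q"
    using pq \<open>verts D \<subseteq> verts C\<close>
    by (intro gdist_subgraph[OF sub(2) connected_graph_cycle[OF G(1) C(1)]]) auto
  finally have "e \<in> edges ?K"
    using e pq \<open>verts D \<subseteq> verts C\<close> by (auto simp: chords_def edge_shortcut_iff[OF G(1)])
  then have "vdist ?K ?p ?q \<le> len G e"
    using vdist_le_len[OF mK, of e ?p ?q] by (simp add: subgraph_eqs[OF sub(1)] joins_def)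
  with \<open>len G e < vdist ?K ?p ?q\<close> show False by simp
qed

lemma short_cycle_through_edge:
  assumes G: "metric_graph G" "locally_finite G" "edge_chordal G k m"
    and C: "cycle G C" "a \<in> edges C"
  obtains D where "cycle G D" "a \<in> edges D" "total_length D < k" "edges D \<subseteq> edges C \<union> chords G C m"
proof -
  note sub = subgraph_add_chords[OF G(1) C(1), of m]
  have "finite (verts (add_chords G C m))" "finite (edges (add_chords G C m))"
    using finite_cycle[OF C(1)] finite_chords[OF G(1,2) C(1)] by simp_all
  moreover have "cycle (add_chords G C m) C"
    using C(1) sub(2) by (simp add: cycle_in_subgraph_iff[OF sub(1)])
  ultimately obtain D where D: "shortest_cycle_through (add_chords G C m) a D"
    using C(2) by (rule ex_shortest_cycle_through)
  then show thesis
    using that[of D] shortest_cycle_throughD(1,2)[OF D] shortest_cycle_add_chords_total_length_less[OF G(1,3) C D]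
    by (auto simp: cycle_in_subgraph_iff[OF sub(1)] subgraph_def)
qed

lemma cycle_edges_not_subset:
  assumes C: "cycle G C" "a \<in> edges C" and D: "cycle G D" "a \<in> edges D" "D \<noteq> C"
  shows "\<not> edges D \<subseteq> edges C"
proof
  assume "edges D \<subseteq> edges C"
  obtain xs where xs: "simple_walk (delete_edge G a) (tgt G a) xs (src G a)" "C = close_walk G a xs"
    using C by (rule cycle_cutE)
  obtain ys where ys: "simple_walk (delete_edge G a) (tgt G a) ys (src G a)" "D = close_walk G a ys"
    using D(1,2) by (rule cycle_cutE)
  have "set (walk_edges ys) \<subseteq> set (walk_edges xs)"
    using \<open>edges D \<subseteq> edges C\<close> ys by (auto simp: xs(2) close_walk_def simple_walk_delete_edge)
  then have "ys = xs" using simple_walk_unique[OF xs(1) ys(1)] by simp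
  then show False using D(3) xs(2) ys(2) by simp
qed

lemma walk_in_subgraph:
  assumes H: "metric_graph H" "subgraph H G"
  shows "walk G u xs v \<Longrightarrow> u \<in> verts H \<Longrightarrow> set (walk_edges xs) \<subseteq> edges H \<Longrightarrow> walk H u xs v"
proof (induction rule: walk_induct)
  case (Cons u e w xs)
  then have "w \<in> verts H"
    using metric_graphD[OF H(1), of e] by (auto simp: joins_def subgraph_eqs[OF H(2)])
  with Cons show ?case by (simp add: subgraph_eqs[OF H(2)])
qed simp

lemma chord_end_near_point:
  assumes G: "metric_graph G" and C: "cycle G C" "a \<in> edges C" "t \<in> {0..len G a}"
    and D: "cycle G D" "a \<in> edges D" "edges D \<subseteq> edges C \<union> chords G C m" "D \<noteq> C"
  obtains e v where "e \<in> chords G C m" "v \<in> {src G e, tgt G e}"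
    "gdist C (Vertex v) (edge_point G a t) \<le> total_length D"
proof -
  note sub = cycle_subgraph[OF C(1)]
  have mC: "metric_graph C" and cC: "connected_graph C"
    using G C(1) by (rule metric_graph_cycle, rule connected_graph_cycle)
  obtain xs where xs: "simple_walk (delete_edge G a) (tgt G a) xs (src G a)" "D = close_walk G a xs"
    using D(1,2) by (rule cycle_cutE)
  then have "\<exists>x \<in> set xs. fst x \<notin> edges C"
    using cycle_edges_not_subset[OF C(1,2) D(1,2,4)] C(2) by (auto simp: close_walk_def)
  then obtain ys e w zs where split: "xs = ys @ (e, w) # zs" "e \<notin> edges C"
    "set (walk_edges ys) \<subseteq> edges C"
    by (fastforce dest!: split_list_first_prop)
  have "e \<in> chords G C m" using D(3) split by (auto simp: xs(2) close_walk_def)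
  obtain v where v: "walk G (tgt G a) ys v" "joins G e v w" "walk G w zs (src G a)"
    using xs(1) by (auto simp: simple_walk_delete_edge simple_walk_def[of G] split(1) walk_append)
  have "tgt G a \<in> verts C"
    using metric_graphD(2)[OF mC C(2)] by (simp add: subgraph_eqs[OF sub])
  with v(1) split(3) have walk_C: "walk C (tgt G a) ys v" by (intro walk_in_subgraph[OF mC sub])
  have points: "Vertex v \<in> points C" "Vertex (tgt G a) \<in> points C" "edge_point G a t \<in> points C"
    using walk_ends_in_verts[OF walk_C] edge_point_in_points[OF C(2), of t] C(3)
    by (auto simp: subgraph_eqs[OF sub])
  have "gdist C (Vertex v) (edge_point G a t) \<le>
      vdist C (tgt G a) v + gdist C (Vertex (tgt G a)) (edge_point G a t)"
    using gdist_triangle[OF cC points] gdist_commute[OF cC points(1,2)] by simp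
  also have "vdist C (tgt G a) v \<le> walk_length G ys"
    using vdist_le_walk_length[OF mC walk_C] by (simp add: walk_length_subgraph[OF sub])
  also have "gdist C (Vertex (tgt G a)) (edge_point G a t) \<le> len G a"
    using gdist_same_edge[OF C(2), of "len G a" t] C(3) edge_point_len[OF mC C(2)]
    by (auto simp: subgraph_eqs[OF sub])
  also have "walk_length G ys + len G a \<le> total_length D"
    using total_length_close_walk[OF xs(1)] walk_length_nonneg[OF v(3) G]
      metric_graphD(3)[OF G, of e] \<open>e \<in> chords G C m\<close>
    by (simp add: xs(2) split(1) chords_def edge_shortcut_iff[OF G])
  finally show thesis using that \<open>e \<in> chords G C m\<close> v(2) by (auto simp: joins_def)
qed

lemma chord_ends_dense:
  assumes G: "metric_graph G" "locally_finite G" "edge_chordal G k m"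
    and C: "cycle G C" "k \<le> total_length C"
  shows "eps_dense (k + 1) (\<Union>e \<in> chords G C m. {Vertex (src G e), Vertex (tgt G e)})
    (points C) (gdist C)"
  unfolding eps_dense_def
proof (intro conjI ballI)
  show "(\<Union>e \<in> chords G C m. {Vertex (src G e), Vertex (tgt G e)}) \<subseteq> points C"
    by (auto simp: chords_def edge_shortcut_iff[OF G(1)])
  fix x assume "x \<in> points C"
  with G(1) C(1) obtain a t where a: "a \<in> edges C" "t \<in> {0..len G a}" "x = edge_point G a t"
    by (rule cycle_point_on_edge)
  obtain D where D: "cycle G D" "a \<in> edges D" "total_length D < k" "edges D \<subseteq> edges C \<union> chords G C m"
    using G C(1) a(1) by (rule short_cycle_through_edge)
  then have "D \<noteq> C" using C(2) by auto
  with G(1) C(1) a(1,2) D(1,2,4) obtain e v where "e \<in> chords G C m" "v \<in> {src G e, tgt G e}"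
    "gdist C (Vertex v) (edge_point G a t) \<le> total_length D"
    by (rule chord_end_near_point)
  then show "\<exists>y \<in> \<Union>e \<in> chords G C m. {Vertex (src G e), Vertex (tgt G e)}. gdist C y x < k + 1"
    using D(3) a(3) by (intro bexI[of _ "Vertex v"]) auto
qed

theorem theorem2p3:
  fixes G :: "('v, 'e) mgraph" and k m :: real
  assumes "metric_graph G" and "connected_graph G" and "locally_finite G"
    and "k \<ge> 0" and "m \<ge> 0"
    and "edge_chordal G k m"
  shows "\<exists>\<epsilon> > 0. densely_path_chordal \<epsilon> G k m"
proof (intro exI conjI)
  show "0 < k + 1" using assms(4) by simp
  show "densely_path_chordal (k + 1) G k m"
    unfolding densely_path_chordal_def
  proof (intro allI impI, elim conjE)
    fix C assume C: "cycle G C" "k \<le> total_length C"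
    let ?S = "(\<lambda>e. ([(e, 0, len G e)], src G e, tgt G e)) ` chords G C m"
    have "finite ?S" using finite_chords[OF assms(1,3) C(1)] by simp
    moreover have "\<forall>(\<sigma>, p, q) \<in> ?S. strict_shortcut G C \<sigma> p q \<and> path_length \<sigma> \<le> m"
      using edge_shortcut_strict[OF assms(1) C(1)] metric_graphD(3)[OF assms(1)]
      by (auto simp: chords_def edge_shortcut_def abs_of_pos)
    moreover have "eps_dense (k + 1) (\<Union>(\<sigma>, p, q) \<in> ?S. {Vertex p, Vertex q}) (points C) (gdist C)"
      using chord_ends_dense[OF assms(1,3,6) C] by simp
    ultimately show "\<exists>S. finite S \<and>
        (\<forall>(\<sigma>, p, q) \<in> S. strict_shortcut G C \<sigma> p q \<and> path_length \<sigma> \<le> m) \<and>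
        eps_dense (k + 1) (\<Union>(\<sigma>, p, q) \<in> S. {Vertex p, Vertex q}) (points C) (gdist C)"
      by (intro exI[of _ ?S] conjI)
  qed
qed

end
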